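(* Let $X$ and $Y$ be Banach spaces such that $X^*$ and $Y$ are separable, and let $\varepsilon>0$. If $X$ or $Y$ has the $(2-\varepsilon)$-UBAP, then for all $\alpha$ with $1-\varepsilon/2<\alpha\le1$, the renormed space $Z_\alpha=(B(X,Y),\|\cdot\|_\alpha)$ has the $(2\alpha,\,2\alpha+\varepsilon-2-\sigma)$-UBCP for all $0<\sigma<2\alpha+\varepsilon-2$.
   Context: $B(X,Y)$ is the space of bounded linear operators with operator norm $\|\cdot\|$, $K(X,Y)$ the subspace of compact operators. For $\alpha\in[0,1]$, $\|T\|_\alpha=\alpha\|T\|+(1-\alpha)\|T\|_{B(X,Y)/K(X,Y)}$, where the last term is the quotient norm of the class of $T$, i.e. its distance to $K(X,Y)$. Approximating sequence on a Banach space $W$: a sequence $\{S_n\}_{n=1}^\infty$ of bounded finite rank operators on $W$ converging strongly (pointwise in norm) to the identity, with $S_mS_n=S_n$ for all $n<m$ (and hence $\limsup_n\|S_n\|<\infty$). $\lambda$-UBAP ($\lambda$-unconditional bounded approximation property): a separable Banach space $W$ has it if for every $\delta>0$ there is an approximating sequence $\{S_n\}$ on $W$ such that, with $S_0=0$ and $A_n=S_n-S_{n-1}$, $\sup_{N\in\mathbb{N}_+,\,\theta_i=\pm1}\|\sum_{i=1}^N\theta_iA_i\|\le\lambda+\delta$. $(r,\delta)$-UBCP (uniform ball-covering property; $r,\delta>0$): a normed space $Z$ has it if there are countably many closed balls $B(z_n,r_n)$ in $Z$ whose union contains the unit sphere of $Z$, with $r_n<\|z_n\|$, $r_n\le r$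 and $B(z_n,r_n)\cap B(0,\delta)=\emptyset$ for all $n$. *)

theory Defs
  imports "HOL-Analysis.Analysis"
begin

text \<open>All Banach spaces are real. The dual of \<open>'a\<close> is \<open>'a \<Rightarrow>\<^sub>L real\<close>, and the space of bounded
  operators is \<open>'a \<Rightarrow>\<^sub>L 'b\<close>, whose class norm is the operator norm.\<close>

definition compact_operator :: "('a::real_normed_vector \<Rightarrow>\<^sub>L 'b::real_normed_vector) \<Rightarrow> bool" where
  "compact_operator T \<longleftrightarrow> compact (closure (blinfun_apply T ` cball 0 1))"

text \<open>The zero operator is compact, so \<^term>\<open>infdist\<close> below is a genuine infimum: the quotient norm
  modulo the compact operators.\<close>

definition alpha_norm :: "real \<Rightarrow> ('a::real_normed_vector \<Rightarrow>\<^sub>L 'b::real_normed_vector) \<Rightarrow> real" where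
  "alpha_norm \<alpha> T = \<alpha> * norm T + (1 - \<alpha>) * infdist T {K. compact_operator K}"

text \<open>Stated with a spanning set because \<^term>\<open>dim\<close> is 0 on infinite-dimensional spaces.\<close>

definition finite_rank :: "('a::real_normed_vector \<Rightarrow>\<^sub>L 'b::real_normed_vector) \<Rightarrow> bool" where
  "finite_rank T \<longleftrightarrow> (\<exists>B. finite B \<and> range (blinfun_apply T) \<subseteq> span B)"

text \<open>The sequence is \<open>S 1, S 2, \<dots>\<close>; nothing is required of \<open>S 0\<close>.\<close>

definition approximating_sequence :: "(nat \<Rightarrow> ('w::banach \<Rightarrow>\<^sub>L 'w)) \<Rightarrow> bool" where
  "approximating_sequence S \<longleftrightarrow>
     (\<forall>n\<ge>1. finite_rank (S n)) \<and>
     (\<forall>x. (\<lambda>n. blinfun_apply (S n) x) \<longlonglongrightarrow> x) \<and>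
     (\<forall>m n. 1 \<le> n \<and> n < m \<longrightarrow> S m o\<^sub>L S n = S n)"

text \<open>The supremum over \<open>N\<close> and \<open>\<theta>\<close> is written as a uniform bound, since \<^term>\<open>Sup\<close> of an
  unbounded set of reals is unspecified.\<close>

definition UBAP :: "'w::banach itself \<Rightarrow> real \<Rightarrow> bool" where
  "UBAP (_ :: 'w itself) c \<longleftrightarrow>
     separable_space (euclidean :: 'w topology) \<and>
     (\<forall>\<delta>>0. \<exists>S :: nat \<Rightarrow> ('w \<Rightarrow>\<^sub>L 'w). approximating_sequence S \<and> S 0 = 0 \<and>
        (\<forall>N\<ge>1. \<forall>\<theta> :: nat \<Rightarrow> real. (\<forall>i. \<theta> i \<in> {1, -1}) \<longrightarrow>
           norm (\<Sum>i=1..N. \<theta> i *\<^sub>R (S i - S (i - 1))) \<le> c + \<delta>))"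

text \<open>The norm is an explicit argument, because the space of operators is considered with norms
  other than its class norm. An element \<open>(z, s)\<close> of \<open>C\<close> stands for the closed ball with centre \<open>z\<close>
  and radius \<open>s\<close>.\<close>

definition norm_cball :: "('z::real_vector \<Rightarrow> real) \<Rightarrow> 'z \<Rightarrow> real \<Rightarrow> 'z set" where
  "norm_cball \<nu> z s = {x. \<nu> (x - z) \<le> s}"

definition UBCP :: "('z::real_vector \<Rightarrow> real) \<Rightarrow> real \<Rightarrow> real \<Rightarrow> bool" where
  "UBCP \<nu> r \<delta> \<longleftrightarrow> 0 < r \<and> 0 < \<delta> \<and>
     (\<exists>C :: ('z \<times> real) set. countable C \<and>
        {x. \<nu> x = 1} \<subseteq> (\<Union>(z, s)\<in>C. norm_cball \<nu> z s) \<and>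
        (\<forall>(z, s)\<in>C. 0 < s \<and> s < \<nu> z \<and> s \<le> r \<and> norm_cball \<nu> z s \<inter> norm_cball \<nu> 0 \<delta> = {}))"

end

theory Submission
  imports Defs
begin

text \<open>Let \<open>S\<^sub>n\<close> be an approximating sequence with unconditional constant at most \<open>2 - \<epsilon> + \<eta>\<close>. Changing
  the signs of the first \<open>n\<close> differences and passing to the strong limit gives
  \<open>\<parallel>I - 2S\<^sub>n\<parallel> \<le> 2 - \<epsilon> + \<eta>\<close>. Since \<open>S\<^sub>n T\<close> (or \<open>T S\<^sub>n\<close>) is compact, \<open>T\<close> and \<open>T - 2S\<^sub>n T\<close> have the same
  distance to the compact operators; hence \<open>\<parallel>T - 2S\<^sub>n T\<parallel>\<^sub>\<alpha> \<le> 2 - \<epsilon> + \<eta>\<close> on the unit sphere of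
  \<open>\<parallel>\<cdot>\<parallel>\<^sub>\<alpha>\<close>, while \<open>\<parallel>2S\<^sub>n T\<parallel>\<^sub>\<alpha> \<ge> 2\<alpha>\<parallel>S\<^sub>n T\<parallel>\<close> is almost \<open>2\<alpha>\<close> for a suitable \<open>n\<close>. The operators \<open>S\<^sub>n T\<close>
  lie in a separable set, because \<open>S\<^sub>n\<close> is a finite sum of rank-one operators, so countably many
  balls of one fixed radius suffice.\<close>

section \<open>Finite rank operators\<close>

text \<open>Induction on \<open>B\<close>: a new vector \<open>a\<close> turns the set into the
  Minkowski sum of the compact segment of multiples of \<open>a\<close> and the compact set for
  \<open>B\<close>.\<close>

lemma compact_bounded_combinations:
  fixes B :: "'a::real_normed_vector set"
  assumes "finite B"
  shows "compact {\<Sum>b\<in>B. u b *\<^sub>R b | u. \<forall>b\<in>B. \<bar>u b\<bar> \<le> R}"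
  using assms
proof (induction B rule: finite_induct)
  case empty
  then show ?case by simp
next
  case (insert a B)
  let ?K = "\<lambda>B. {\<Sum>b\<in>B. u b *\<^sub>R b | u. \<forall>b\<in>B. \<bar>u b\<bar> \<le> R}"
  have "?K (insert a B) = {x + y | x y. x \<in> (\<lambda>t. t *\<^sub>R a) ` {-R..R} \<and> y \<in> ?K B}" (is "_ = ?P")
  proof (rule set_eqI, rule iffI)
    fix v assume "v \<in> ?K (insert a B)"
    then obtain u where u: "v = (\<Sum>b\<in>insert a B. u b *\<^sub>R b)" "\<forall>b\<in>insert a B. \<bar>u b\<bar> \<le> R"
      by blast
    have "u a *\<^sub>R a \<in> (\<lambda>t. t *\<^sub>R a) ` {-R..R}"
      using u(2) by (intro imageI) (auto simp: abs_le_iff)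
    moreover have "(\<Sum>b\<in>B. u b *\<^sub>R b) \<in> ?K B" using u(2) by blast
    moreover have "v = u a *\<^sub>R a + (\<Sum>b\<in>B. u b *\<^sub>R b)" using u(1) insert.hyps by simp
    ultimately show "v \<in> ?P" by blast
  next
    fix v assume "v \<in> ?P"
    then obtain t u where tu: "v = t *\<^sub>R a + (\<Sum>b\<in>B. u b *\<^sub>R b)" "t \<in> {-R..R}"
        "\<forall>b\<in>B. \<bar>u b\<bar> \<le> R"
      by blast
    have "(\<Sum>b\<in>B. (u(a := t)) b *\<^sub>R b) = (\<Sum>b\<in>B. u b *\<^sub>R b)"
      using insert.hyps by (intro sum.cong) auto
    then have "v = (\<Sum>b\<in>insert a B. (u(a := t)) b *\<^sub>R b)"
      using tu(1) insert.hyps by simp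
    moreover have "\<forall>b\<in>insert a B. \<bar>(u(a := t)) b\<bar> \<le> R" using tu by auto
    ultimately show "v \<in> ?K (insert a B)" by blast
  qed
  moreover have "compact ((\<lambda>t. t *\<^sub>R a) ` {-R..R})"
    by (intro compact_continuous_image continuous_intros) auto
  ultimately show ?case
    using compact_sums[OF _ insert.IH] by simp
qed

text \<open>Coordinates on a finite-dimensional span are bounded functionals. In the induction, the
  new vector \<open>a\<close> has positive distance from \<open>span B\<close>: only combinations of
  norm at most \<open>norm a + 1\<close> can come close to it, and these lie in a compact set
  missing \<open>a\<close>.\<close>

lemma independent_coefficient_bound:
  fixes B :: "'a::real_normed_vector set"
  assumes "finite B" "independent B"
  obtains M where "0 \<le> M" "\<And>u b. b \<in> B \<Longrightarrow> \<bar>u b\<bar> \<le> M * norm (\<Sum>b\<in>B. u b *\<^sub>R b)"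
proof -
  have "\<exists>M\<ge>0. \<forall>u. \<forall>b\<in>B. \<bar>u b\<bar> \<le> M * norm (\<Sum>b\<in>B. u b *\<^sub>R b)"
    using assms
  proof (induction B rule: finite_induct)
    case empty
    then show ?case by auto
  next
    case (insert a B)
    have a: "a \<notin> span B" and "independent B"
      using insert.prems insert.hyps by (auto simp: independent_insert)
    with insert.IH obtain M where M: "0 \<le> M"
        "\<And>u b. b \<in> B \<Longrightarrow> \<bar>u b\<bar> \<le> M * norm (\<Sum>b\<in>B. u b *\<^sub>R b)"
      by blast
    \<comment> \<open>By the bound for \<open>B\<close>, \<open>K\<close> contains every element of
      \<open>span B\<close> of norm at most \<open>norm a + 1\<close>.\<close>
    define K where
      "K = {\<Sum>b\<in>B. u b *\<^sub>R b | u. \<forall>b\<in>B. \<bar>u b\<bar> \<le> M * (norm a + 1)}"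
    have "closed K"
      unfolding K_def using compact_bounded_combinations[OF insert.hyps(1)] by (rule compact_imp_closed)
    moreover have "K \<subseteq> span B"
      unfolding K_def by (auto intro!: span_sum span_scale intro: span_base)
    then have "a \<notin> K" using a by blast
    ultimately obtain e where e: "0 < e" "ball a e \<inter> K = {}"
      by (metis Compl_iff open_Compl openE disjoint_eq_subset_Compl)
    \<comment> \<open>The cap 1 forces any element of \<open>span B\<close> within \<open>d\<close>
      of \<open>a\<close> to have norm at most \<open>norm a + 1\<close>, hence to lie in
      \<open>K\<close>; the bound \<open>e\<close> then excludes it.\<close>
    define d where "d = min e 1"
    have d: "d > 0" using e by (simp add: d_def)
    have far: "d \<le> norm (a + (\<Sum>b\<in>B. u b *\<^sub>R b))" for u
    proof (rule ccontr)
      assume "\<not> ?thesis"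
      then have *: "norm (a + (\<Sum>b\<in>B. u b *\<^sub>R b)) < d" by simp
      let ?y = "\<Sum>b\<in>B. - u b *\<^sub>R b"
      have y: "?y = - (\<Sum>b\<in>B. u b *\<^sub>R b)" by (simp add: sum_negf)
      have "norm ?y \<le> norm a + 1"
        using * norm_triangle_ineq2[of "\<Sum>b\<in>B. u b *\<^sub>R b" "- a"] unfolding y d_def
        by (simp add: add.commute)
      then have "\<forall>b\<in>B. \<bar>- u b\<bar> \<le> M * (norm a + 1)"
        using M by (meson mult_left_mono order_trans)
      then have "?y \<in> K" unfolding K_def
        by (auto intro!: exI[of _ "\<lambda>b. - u b"])
      moreover have "?y \<in> ball a e"
        using * unfolding y d_def by (simp add: dist_norm)
      ultimately show False using e(2) by blast
    qed
    \<comment> \<open>The first summand bounds the coefficient of \<open>a\<close>. Removing the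
      \<open>a\<close>-component of \<open>v\<close> leaves a vector of norm at most
      \<open>(1 + norm a / d) * norm v\<close>, to which \<open>M\<close> applies.\<close>
    define M' where "M' = 1 / d + M * (1 + norm a / d)"
    have "M' \<ge> 0" unfolding M'_def using M d by auto
    moreover have "\<bar>u b\<bar> \<le> M' * norm (\<Sum>b\<in>insert a B. u b *\<^sub>R b)" if b: "b \<in> insert a B" for u b
    proof -
      let ?y = "\<Sum>b\<in>B. u b *\<^sub>R b"
      define v where "v = u a *\<^sub>R a + ?y"
      have v: "(\<Sum>b\<in>insert a B. u b *\<^sub>R b) = v" using insert.hyps by (simp add: v_def)
      have ua: "\<bar>u a\<bar> \<le> 1 / d * norm v"
      proof (cases "u a = 0")
        case False
        have "v = u a *\<^sub>R (a + (\<Sum>b\<in>B. (u b / u a) *\<^sub>R b))"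
          using False by (simp add: v_def scaleR_add_right scaleR_sum_right)
        then have "norm v = \<bar>u a\<bar> * norm (a + (\<Sum>b\<in>B. (u b / u a) *\<^sub>R b))" by simp
        with far[of "\<lambda>b. u b / u a"] have "norm v \<ge> \<bar>u a\<bar> * d"
          by (simp add: mult_left_mono)
        then show ?thesis using d by (simp add: field_simps)
      qed (use d in simp)
      show ?thesis
      proof (cases "b = a")
        case True
        have "1 / d * norm v \<le> M' * norm v"
          unfolding M'_def using M d by (intro mult_right_mono) auto
        then show ?thesis using ua v True by simp
      next
        case False
        then have "\<bar>u b\<bar> \<le> M * norm ?y" using M b by auto
        also have "norm ?y \<le> norm v + \<bar>u a\<bar> * norm a"
          using norm_triangle_ineq4[of v "u a *\<^sub>R a"] by (simp add: v_def)
        also have "\<dots> \<le> norm v + (1 / d * norm v) * norm a"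
          using ua by (intro add_left_mono mult_right_mono) auto
        also have "\<dots> = (1 + norm a / d) * norm v" by (simp add: field_simps)
        finally have "\<bar>u b\<bar> \<le> M * ((1 + norm a / d) * norm v)"
          using M by (simp add: mult_left_mono)
        also have "\<dots> \<le> M' * norm v"
          unfolding M'_def using d by (simp add: algebra_simps)
        finally show ?thesis using v by simp
      qed
    qed
    ultimately show ?case by blast
  qed
  then show ?thesis using that by blast
qed

text \<open>The coordinates of \<open>S x\<close> in a finite independent set are bounded
  functionals \<open>f b\<close> of \<open>x\<close>, so \<open>S\<close> is the sum of the rank-one
  operators sending \<open>x\<close> to \<open>f b x *\<^sub>R b\<close>.\<close>

lemma finite_rank_representation:
  fixes S :: "'a::real_normed_vector \<Rightarrow>\<^sub>L 'b::real_normed_vector"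
  assumes "finite_rank S"
  obtains B and f :: "'b \<Rightarrow> 'a \<Rightarrow>\<^sub>L real"
  where "finite B" "S = (\<Sum>b\<in>B. blinfun_scaleR_left b o\<^sub>L f b)"
proof -
  obtain B0 where B0: "finite B0" "range (blinfun_apply S) \<subseteq> span B0"
    using assms unfolding finite_rank_def by blast
  obtain B where B: "B \<subseteq> B0" "independent B" "B0 \<subseteq> span B"
    using maximal_independent_subset by blast
  have fin: "finite B" using B B0 finite_subset by blast
  have S: "S x \<in> span B" for x
    using B0(2) B(3) by (metis range_subsetD span_minimal subset_iff subspace_span)
  obtain M where M: "0 \<le> M" "\<And>u b. b \<in> B \<Longrightarrow> \<bar>u b\<bar> \<le> M * norm (\<Sum>b\<in>B. u b *\<^sub>R b)"
    using independent_coefficient_bound[OF fin B(2)] by blast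
  have sum_rep: "(\<Sum>b\<in>B. representation B (S x) b *\<^sub>R b) = S x" for x
    using B(2) S fin by (intro real_vector.sum_representation_eq) auto
  have bl: "bounded_linear (\<lambda>x. representation B (S x) b)" if "b \<in> B" for b
  proof (rule bounded_linear_intro)
    fix x
    have "\<bar>representation B (S x) b\<bar> \<le> M * norm (S x)"
      using M(2)[OF that, of "representation B (S x)"] sum_rep by simp
    also have "\<dots> \<le> M * (norm S * norm x)"
      using M(1) norm_blinfun by (intro mult_left_mono)
    finally show "norm (representation B (S x) b) \<le> norm x * (M * norm S)"
      by (simp add: ac_simps)
  qed (use B(2) S in \<open>simp_all add: blinfun.add_right blinfun.scaleR_right
        real_vector.representation_add real_vector.representation_scale\<close>)
  define f where "f b = Blinfun (\<lambda>x. representation B (S x) b)" for b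
  have "S x = (\<Sum>b\<in>B. blinfun_scaleR_left b o\<^sub>L f b) x" for x
    using sum_rep[of x] by (simp add: blinfun.sum_left f_def bounded_linear_Blinfun_apply[OF bl])
  then show ?thesis using that[OF fin] blinfun_eqI by metis
qed

section \<open>Compactness of finite rank operators\<close>

lemma compact_operatorI:
  assumes "compact K" "blinfun_apply S ` cball 0 1 \<subseteq> K"
  shows "compact_operator S"
proof -
  have "closure (blinfun_apply S ` cball 0 1) \<subseteq> K"
    using assms by (simp add: closure_minimal compact_imp_closed)
  then have "closure (blinfun_apply S ` cball 0 1) = K \<inter> closure (blinfun_apply S ` cball 0 1)"
    by blast
  then show ?thesis
    unfolding compact_operator_def using compact_Int_closed[OF assms(1) closed_closure] by metis
qed

lemma finite_rank_imp_compact: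
  fixes S :: "'a::real_normed_vector \<Rightarrow>\<^sub>L 'b::real_normed_vector"
  assumes "finite_rank S"
  shows "compact_operator S"
proof -
  obtain B and f :: "'b \<Rightarrow> 'a \<Rightarrow>\<^sub>L real" where
    Bf: "finite B" "S = (\<Sum>b\<in>B. blinfun_scaleR_left b o\<^sub>L f b)"
    using finite_rank_representation[OF assms] .
  \<comment> \<open>A single bound for all coefficients on the unit ball: the sum dominates each
    \<open>norm (f b)\<close>.\<close>
  define R where "R = (\<Sum>b\<in>B. norm (f b))"
  let ?K = "{\<Sum>b\<in>B. u b *\<^sub>R b | u. \<forall>b\<in>B. \<bar>u b\<bar> \<le> R}"
  have "S x \<in> ?K" if "x \<in> cball 0 1" for x
  proof -
    have "\<bar>f b x\<bar> \<le> R" if "b \<in> B" for b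
    proof -
      have "\<bar>f b x\<bar> \<le> norm (f b) * norm x" using norm_blinfun[of "f b" x] by simp
      also have "\<dots> \<le> norm (f b)" using \<open>x \<in> cball 0 1\<close> by (simp add: mult_left_le)
      also have "\<dots> \<le> R" unfolding R_def using that Bf(1) by (intro member_le_sum) auto
      finally show ?thesis .
    qed
    then show ?thesis by (auto simp: Bf(2) blinfun.sum_left intro!: exI[of _ "\<lambda>b. f b x"])
  qed
  then show ?thesis
    by (intro compact_operatorI[OF compact_bounded_combinations[OF Bf(1)]]) blast
qed

lemma finite_rank_compose_left:
  assumes "finite_rank S"
  shows "finite_rank (S o\<^sub>L T)"
proof -
  have "range (blinfun_apply (S o\<^sub>L T)) \<subseteq> range (blinfun_apply S)" by auto
  then show ?thesis using assms unfolding finite_rank_def by (meson order_trans)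
qed

lemma finite_rank_compose_right:
  assumes "finite_rank S"
  shows "finite_rank (T o\<^sub>L S)"
proof -
  obtain B where B: "finite B" "range (blinfun_apply S) \<subseteq> span B"
    using assms unfolding finite_rank_def by blast
  have "range (blinfun_apply (T o\<^sub>L S)) = T ` range (blinfun_apply S)" by auto
  also have "\<dots> \<subseteq> T ` span B" using B(2) by blast
  also have "\<dots> = span (T ` B)"
    by (simp add: blinfun.bounded_linear_right bounded_linear.linear linear_span_image)
  finally show ?thesis unfolding finite_rank_def using B(1) by blast
qed

section \<open>The norm modulo the compact operators\<close>

lemma compact_operator_add:
  assumes "compact_operator S" "compact_operator T"
  shows "compact_operator (S + T)"
proof -
  let ?A = "closure (blinfun_apply S ` cball 0 1)" and ?B = "closure (blinfun_apply T ` cball 0 1)"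
  let ?K = "{x + y | x y. x \<in> ?A \<and> y \<in> ?B}"
  have K: "compact ?K" using assms unfolding compact_operator_def by (rule compact_sums)
  have "blinfun_apply (S + T) ` cball 0 1 \<subseteq> ?K"
  proof
    fix v assume "v \<in> blinfun_apply (S + T) ` cball 0 1"
    then obtain x where x: "x \<in> cball 0 1" "v = S x + T x" by (auto simp: blinfun.add_left)
    have "S x \<in> ?A" "T x \<in> ?B" using x(1) by (auto intro: subsetD[OF closure_subset])
    then show "v \<in> ?K" using x(2) by blast
  qed
  then show ?thesis using K by (rule compact_operatorI[rotated])
qed

lemma compact_operator_scaleR:
  assumes "compact_operator S"
  shows "compact_operator (c *\<^sub>R S)"
proof -
  have "blinfun_apply (c *\<^sub>R S) ` cball 0 1 = (\<lambda>x. c *\<^sub>R x) ` (blinfun_apply S ` cball 0 1)"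
    by (auto simp: blinfun.scaleR_left image_image)
  then have "closure (blinfun_apply (c *\<^sub>R S) ` cball 0 1)
      = (\<lambda>x. c *\<^sub>R x) ` closure (blinfun_apply S ` cball 0 1)"
    by (simp add: closure_scaleR)
  then show ?thesis using assms unfolding compact_operator_def by (simp add: compact_scaling)
qed

lemma compact_operator_zero: "compact_operator 0"
  by (simp add: compact_operator_def image_constant_conv)

abbreviation compact_dist :: "('a::real_normed_vector \<Rightarrow>\<^sub>L 'b::real_normed_vector) \<Rightarrow> real" where
  "compact_dist T \<equiv> infdist T {K. compact_operator K}"

lemma compact_dist_le_norm: "compact_dist T \<le> norm T"
  using infdist_le[of 0 "{K. compact_operator K}" T] by (simp add: compact_operator_zero)

text \<open>A best compact approximant need not exist, so the estimates below use approximants that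
  are optimal up to \<open>e\<close>.\<close>

lemma compact_dist_witness:
  fixes T :: "'a::real_normed_vector \<Rightarrow>\<^sub>L 'b::real_normed_vector"
  assumes "0 < e"
  obtains K where "compact_operator K" "norm (T - K) < compact_dist T + e"
proof -
  have ne: "{K. compact_operator K} \<noteq> ({} :: ('a \<Rightarrow>\<^sub>L 'b) set)"
    using compact_operator_zero by blast
  then have "Inf (dist T ` {K. compact_operator K}) < compact_dist T + e"
    using assms by (simp add: infdist_notempty)
  with ne have "\<exists>d\<in>dist T ` {K. compact_operator K}. d < compact_dist T + e"
    by (intro cInf_lessD) auto
  then show ?thesis using that by (auto simp: dist_norm)
qed

text \<open>The sum of nearly optimal compact approximants of \<open>S\<close> and \<open>T\<close>
  is a compact approximant of \<open>S + T\<close>.\<close>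

lemma compact_dist_triangle: "compact_dist (S + T) \<le> compact_dist S + compact_dist T"
proof (rule field_le_epsilon)
  fix e :: real assume "0 < e"
  then have e2: "0 < e / 2" by simp
  obtain K where K: "compact_operator K" "norm (S - K) < compact_dist S + e / 2"
    using compact_dist_witness[OF e2] .
  obtain L where L: "compact_operator L" "norm (T - L) < compact_dist T + e / 2"
    using compact_dist_witness[OF e2] .
  have "compact_dist (S + T) \<le> norm (S + T - (K + L))"
    using compact_operator_add[OF K(1) L(1)] infdist_le by (metis dist_norm mem_Collect_eq)
  also have "\<dots> \<le> norm (S - K) + norm (T - L)"
    using norm_triangle_ineq[of "S - K" "T - L"] by (simp add: algebra_simps)
  finally show "compact_dist (S + T) \<le> compact_dist S + compact_dist T + e"
    using K L by simp
qed

lemma compact_dist_uminus: "compact_dist (- T) = compact_dist T"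
proof -
  have "compact_dist (- S) \<le> compact_dist S" for S :: "'a \<Rightarrow>\<^sub>L 'b"
  proof (rule field_le_epsilon)
    fix e :: real assume e: "0 < e"
    obtain K where K: "compact_operator K" "norm (S - K) < compact_dist S + e"
      using compact_dist_witness[OF e] .
    have "compact_dist (- S) \<le> norm (- S - (- 1) *\<^sub>R K)"
      using compact_operator_scaleR[OF K(1)] infdist_le by (metis dist_norm mem_Collect_eq)
    also have "\<dots> = norm (S - K)" by (simp add: norm_minus_commute)
    finally show "compact_dist (- S) \<le> compact_dist S + e" using K by simp
  qed
  from this[of T] this[of "- T"] show ?thesis by simp
qed

section \<open>Estimates for the norm \<open>alpha_norm\<close>\<close>

context
  fixes \<alpha> :: real
  assumes \<alpha>: "0 \<le> \<alpha>" "\<alpha> \<le> 1"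
begin

lemma alpha_norm_triangle: "alpha_norm \<alpha> (S + T) \<le> alpha_norm \<alpha> S + alpha_norm \<alpha> T"
proof -
  have "\<alpha> * norm (S + T) \<le> \<alpha> * (norm S + norm T)"
    using \<alpha> by (intro mult_left_mono norm_triangle_ineq)
  moreover have "(1 - \<alpha>) * compact_dist (S + T) \<le> (1 - \<alpha>) * (compact_dist S + compact_dist T)"
    using \<alpha> by (intro mult_left_mono compact_dist_triangle) auto
  ultimately show ?thesis unfolding alpha_norm_def by (simp add: algebra_simps)
qed

lemma alpha_norm_uminus: "alpha_norm \<alpha> (- T) = alpha_norm \<alpha> T"
  by (simp add: alpha_norm_def compact_dist_uminus)

lemma alpha_norm_le_norm: "alpha_norm \<alpha> T \<le> norm T"
proof -
  have "(1 - \<alpha>) * compact_dist T \<le> (1 - \<alpha>) * norm T"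
    using \<alpha> by (intro mult_left_mono compact_dist_le_norm) auto
  then show ?thesis unfolding alpha_norm_def by (simp add: algebra_simps)
qed

lemma alpha_norm_ge: "\<alpha> * norm T \<le> alpha_norm \<alpha> T"
  using \<alpha> by (simp add: alpha_norm_def infdist_nonneg)

text \<open>Subtracting a compact operator does not increase the quotient norm, and
  \<open>1 \<le> c\<close> allows that part to be scaled by \<open>c\<close> too. An estimate for
  the operator norm alone thus passes to the mixed norm.\<close>

lemma alpha_norm_diff_compact:
  assumes "compact_operator K" "norm (T - K) \<le> c * norm T" "1 \<le> c"
  shows "alpha_norm \<alpha> (T - K) \<le> c * alpha_norm \<alpha> T"
proof -
  have "compact_dist (T - K) \<le> compact_dist T"
    using compact_dist_triangle[of T "- K"] assms(1) by (simp add: compact_dist_uminus)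
  also have "\<dots> \<le> c * compact_dist T"
    using assms(3) infdist_nonneg by (metis mult_1 mult_right_mono)
  finally have "(1 - \<alpha>) * compact_dist (T - K) \<le> (1 - \<alpha>) * (c * compact_dist T)"
    using \<alpha> by (intro mult_left_mono) auto
  moreover have "\<alpha> * norm (T - K) \<le> \<alpha> * (c * norm T)"
    using \<alpha> assms(2) by (intro mult_left_mono)
  ultimately show ?thesis unfolding alpha_norm_def by (simp add: algebra_simps)
qed

end

section \<open>Covering the unit sphere\<close>

text \<open>The assumption \<open>approx\<close> isolates what the two cases, approximation in the
  domain or in the codomain, have in common. All balls get the same radius \<open>r\<close>;
  \<open>\<epsilon> \<le> 1\<close> makes the factor \<open>2 - \<epsilon> + \<eta> / 4\<close> at
  least 1, as the estimate for compact perturbations requires.\<close>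

lemma UBCP_alpha_norm:
  fixes \<epsilon> \<alpha> \<sigma> :: real
  assumes \<epsilon>: "0 < \<epsilon>" "\<epsilon> \<le> 1"
    and \<alpha>: "1 - \<epsilon> / 2 < \<alpha>" "\<alpha> \<le> 1"
    and \<sigma>: "0 < \<sigma>" "\<sigma> < 2 * \<alpha> + \<epsilon> - 2"
    and approx: "\<And>\<eta>. 0 < \<eta> \<Longrightarrow> \<exists>D :: ('a::real_normed_vector \<Rightarrow>\<^sub>L 'b::real_normed_vector) set.
      countable D \<and> (\<forall>T. \<exists>F \<in> closure D. compact_operator F \<and>
        norm (T - 2 *\<^sub>R F) \<le> (2 - \<epsilon> + \<eta>) * norm T \<and> norm T - \<eta> \<le> norm F)"
  shows "UBCP (alpha_norm \<alpha> :: ('a \<Rightarrow>\<^sub>L 'b) \<Rightarrow> real) (2 * \<alpha>) (2 * \<alpha> + \<epsilon> - 2 - \<sigma>)"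
proof -
  \<comment> \<open>Centres have norm at least \<open>2 * \<alpha> - \<eta>\<close> and the radius
    is \<open>2 - \<epsilon> + \<eta>\<close>. A point in both a covering ball and the ball about 0
    would force the centre's norm down to \<open>2 * \<alpha> - \<sigma> + \<eta>\<close>, which is
    \<open>2 * \<alpha> - 2 * \<eta>\<close>.\<close>
  define \<eta> where "\<eta> = \<sigma> / 3"
  define r where "r = 2 - \<epsilon> + \<eta>"
  have \<eta>: "0 < \<eta>" "3 * \<eta> = \<sigma>" using \<sigma> by (auto simp: \<eta>_def)
  have \<alpha>01: "0 \<le> \<alpha>" "\<alpha> \<le> 1" using \<alpha> \<epsilon> by auto
  note triangle = alpha_norm_triangle[OF \<alpha>01] and uminus = alpha_norm_uminus[OF \<alpha>01]
    and le_norm = alpha_norm_le_norm[OF \<alpha>01] and ge = alpha_norm_ge[OF \<alpha>01]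
  \<comment> \<open>Replacing \<open>2 *\<^sub>R F\<close> by \<open>2 *\<^sub>R d\<close> with
    \<open>d\<close> in \<open>D\<close> costs up to \<open>\<eta> / 2\<close>; with the
    \<open>\<eta> / 4\<close> from \<open>approx\<close> the total stays below
    \<open>\<eta>\<close>.\<close>
  have "0 < \<eta> / 4" using \<eta> by simp
  from approx[OF this] obtain D :: "('a \<Rightarrow>\<^sub>L 'b) set" where D: "countable D"
    "\<And>T. \<exists>F \<in> closure D. compact_operator F \<and>
        norm (T - 2 *\<^sub>R F) \<le> (2 - \<epsilon> + \<eta> / 4) * norm T \<and> norm T - \<eta> / 4 \<le> norm F"
    by blast
  \<comment> \<open>Centres that are too small are discarded, so every remaining ball avoids the
    ball about 0; the centres needed for the covering survive.\<close>
  define Z where "Z = {z \<in> (\<lambda>d. 2 *\<^sub>R d) ` D. 2 * \<alpha> - \<eta> \<le> alpha_norm \<alpha> z}"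
  have "countable ((\<lambda>z. (z, r)) ` Z)"
    unfolding Z_def using D(1) by (intro countable_image countable_Collect) auto
  moreover have "{T. alpha_norm \<alpha> T = 1} \<subseteq> (\<Union>(z, s)\<in>(\<lambda>z. (z, r)) ` Z. norm_cball (alpha_norm \<alpha>) z s)"
  proof
    fix T :: "'a \<Rightarrow>\<^sub>L 'b" assume "T \<in> {T. alpha_norm \<alpha> T = 1}"
    then have T: "alpha_norm \<alpha> T = 1" by simp
    obtain F where F: "F \<in> closure D" "compact_operator F"
      "norm (T - 2 *\<^sub>R F) \<le> (2 - \<epsilon> + \<eta> / 4) * norm T" "norm T - \<eta> / 4 \<le> norm F"
      using D(2) by blast
    obtain d where d: "d \<in> D" "dist d F < \<eta> / 4"
      using F(1) \<eta> closure_approachable[of F D] by (metis zero_less_divide_iff zero_less_numeral)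
    have dF: "norm (2 *\<^sub>R F - 2 *\<^sub>R d) \<le> \<eta> / 2"
      using d(2) by (simp add: dist_norm norm_minus_commute flip: scaleR_diff_right)
    have "alpha_norm \<alpha> (T - 2 *\<^sub>R F) \<le> 2 - \<epsilon> + \<eta> / 4"
      using alpha_norm_diff_compact[OF \<alpha>01 compact_operator_scaleR[OF F(2)] F(3)] T \<epsilon> \<eta> by simp
    moreover have "alpha_norm \<alpha> (2 *\<^sub>R F - 2 *\<^sub>R d) \<le> \<eta> / 2"
      using le_norm dF order_trans by blast
    ultimately have "alpha_norm \<alpha> (T - 2 *\<^sub>R d) \<le> r"
      using triangle[of "T - 2 *\<^sub>R F" "2 *\<^sub>R F - 2 *\<^sub>R d"] \<eta> by (simp add: r_def)
    moreover have "2 * \<alpha> - \<eta> \<le> alpha_norm \<alpha> (2 *\<^sub>R d)"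
    proof -
      \<comment> \<open>The mixed norm is at most the operator norm, so \<open>F\<close> has norm at
        least \<open>1 - \<eta> / 4\<close>, and \<open>d\<close> loses at most another
        \<open>\<eta> / 4\<close>.\<close>
      have "1 \<le> norm T" using le_norm[of T] T by simp
      moreover have "norm F \<le> norm d + \<eta> / 4"
        using d(2) norm_triangle_ineq2[of F d] by (simp add: dist_norm norm_minus_commute)
      ultimately have "1 - \<eta> / 2 \<le> norm d" using F(4) by simp
      then have "\<alpha> * (2 - \<eta>) \<le> \<alpha> * norm (2 *\<^sub>R d)"
        using \<alpha>01 by (intro mult_left_mono) auto
      moreover have "\<alpha> * \<eta> \<le> 1 * \<eta>" using \<alpha>01 \<eta> by (intro mult_right_mono) auto
      ultimately show ?thesis using ge[of "2 *\<^sub>R d"] by (simp add: algebra_simps)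
    qed
    ultimately show "T \<in> (\<Union>(z, s)\<in>(\<lambda>z. (z, r)) ` Z. norm_cball (alpha_norm \<alpha>) z s)"
      using d(1) by (auto simp: Z_def norm_cball_def)
  qed
  moreover have "0 < r \<and> r < alpha_norm \<alpha> z \<and> r \<le> 2 * \<alpha> \<and>
      norm_cball (alpha_norm \<alpha>) z r \<inter> norm_cball (alpha_norm \<alpha>) 0 (2 * \<alpha> + \<epsilon> - 2 - \<sigma>) = {}"
    if "z \<in> Z" for z
  proof -
    have z: "2 * \<alpha> - \<eta> \<le> alpha_norm \<alpha> z" using that by (simp add: Z_def)
    have False if x: "alpha_norm \<alpha> (x - z) \<le> r" "alpha_norm \<alpha> x \<le> 2 * \<alpha> + \<epsilon> - 2 - \<sigma>" for x
      using triangle[of x "- (x - z)"] uminus[of "x - z"] x z \<eta> by (simp add: r_def)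
    then show ?thesis
      using z \<epsilon> \<alpha> \<sigma> \<eta> by (auto simp: r_def norm_cball_def)
  qed
  ultimately show ?thesis
    unfolding UBCP_def using \<sigma> \<alpha> \<epsilon> by (intro conjI exI[of _ "(\<lambda>z. (z, r)) ` Z"]) auto
qed

section \<open>Consequences of the approximation property\<close>

text \<open>One countable set approximates the sums for all choices \<open>h\<close>. In the
  induction, the map from a point and a partial sum to the new sum is continuous, so it carries the
  closure of a countable product into the closure of its countable image.\<close>

lemma separable_finite_sums:
  fixes g :: "'i \<Rightarrow> 'c::topological_space \<Rightarrow> 'd::real_normed_vector"
  assumes "separable_space (euclidean :: 'c topology)" "finite I"
    and "\<And>i. i \<in> I \<Longrightarrow> continuous_on UNIV (g i)"
  obtains D where "countable D" "\<And>h. (\<Sum>i\<in>I. g i (h i)) \<in> closure D"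
proof -
  obtain Q :: "'c set" where Q: "countable Q" "closure Q = UNIV"
    using assms(1) by (auto simp: separable_space_def)
  have "\<exists>D. countable D \<and> (\<forall>h. (\<Sum>i\<in>I. g i (h i)) \<in> closure D)"
    using assms(2,3)
  proof (induction I rule: finite_induct)
    case empty
    show ?case by (rule exI[of _ "{0}"]) simp
  next
    case (insert j I)
    then obtain D where D: "countable D" "\<And>h. (\<Sum>i\<in>I. g i (h i)) \<in> closure D"
      by auto
    let ?\<phi> = "\<lambda>p. g j (fst p) + snd p"
    have "continuous_on UNIV ?\<phi>"
      using continuous_on_compose2[OF insert.prems[of j] continuous_on_fst[OF continuous_on_id]]
      by (intro continuous_on_add continuous_on_snd continuous_on_id) auto
    then have *: "?\<phi> ` closure (Q \<times> D) \<subseteq> closure (?\<phi> ` (Q \<times> D))"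
      by (intro image_closure_subset closure_subset closed_closure) (rule continuous_on_subset, auto)
    have "(\<Sum>i\<in>insert j I. g i (h i)) \<in> closure (?\<phi> ` (Q \<times> D))" for h
    proof -
      have "(h j, \<Sum>i\<in>I. g i (h i)) \<in> closure (Q \<times> D)"
        using Q D by (simp add: closure_Times)
      from imageI[OF this, of ?\<phi>] * show ?thesis
        using insert.hyps by auto
    qed
    moreover have "countable (?\<phi> ` (Q \<times> D))" using Q(1) D(1) by auto
    ultimately show ?case by blast
  qed
  then show ?thesis using that by blast
qed

text \<open>Only the sign patterns that flip an initial segment are needed. The last conclusion is
  the estimate for \<open>n = 0\<close>, kept separately because it forces \<open>c\<close> to be at
  least 1 on a nonzero space.\<close>

lemma UBAP_sequence:
  assumes "UBAP TYPE('w::banach) c" "0 < \<eta>"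
  obtains S :: "nat \<Rightarrow> 'w::banach \<Rightarrow>\<^sub>L 'w"
  where "approximating_sequence S"
    "\<And>n x. 1 \<le> n \<Longrightarrow> norm (x - 2 *\<^sub>R S n x) \<le> (c + \<eta>) * norm x"
    "\<And>x :: 'w. norm x \<le> (c + \<eta>) * norm x"
proof -
  obtain S :: "nat \<Rightarrow> 'w \<Rightarrow>\<^sub>L 'w" where S: "approximating_sequence S" "S 0 = 0"
    "\<And>N \<theta>. 1 \<le> N \<Longrightarrow> (\<And>i. \<theta> i \<in> {1, -1}) \<Longrightarrow>
        norm (\<Sum>i=1..N. \<theta> i *\<^sub>R (S i - S (i - 1))) \<le> c + \<eta>"
    using assms unfolding UBAP_def by blast
  have lim: "(\<lambda>n. S n x) \<longlonglongrightarrow> x" for x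
    using S(1) by (simp add: approximating_sequence_def)
  \<comment> \<open>Without signs the sum telescopes to \<open>S N\<close>, as
    \<open>S 0 = 0\<close>; flipping its first terms subtracts twice their sum. The minimum also
    covers \<open>N < n\<close>, through which the induction on \<open>N\<close> passes.\<close>
  have flip: "(\<Sum>i=1..N. (if i \<le> n then -1 else 1) *\<^sub>R (S i - S (i - 1))) = S N - 2 *\<^sub>R S (min n N)"
    for n N
    by (induction N) (auto simp: S(2) min_def not_le le_Suc_eq algebra_simps scaleR_2)
  have bound: "norm (x - 2 *\<^sub>R S n x) \<le> (c + \<eta>) * norm x" for n x
  proof (rule tendsto_upperbound)
    show "(\<lambda>N. norm (S N x - 2 *\<^sub>R S n x)) \<longlonglongrightarrow> norm (x - 2 *\<^sub>R S n x)"
      by (intro tendsto_intros lim)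
    show "\<forall>\<^sub>F N in sequentially. norm (S N x - 2 *\<^sub>R S n x) \<le> (c + \<eta>) * norm x"
      using eventually_ge_at_top[of "max 1 n"]
    proof eventually_elim
      case (elim N)
      have "norm (S N - 2 *\<^sub>R S n) \<le> c + \<eta>"
        using S(3)[of N "\<lambda>i. if i \<le> n then -1 else 1"] flip[where N = N and n = n] elim
        by (simp add: min_absorb1)
      moreover have "norm (S N x - 2 *\<^sub>R S n x) \<le> norm (S N - 2 *\<^sub>R S n) * norm x"
        using norm_blinfun[of "S N - 2 *\<^sub>R S n" x]
        by (simp add: blinfun.diff_left blinfun.scaleR_left)
      ultimately show ?case
        by (meson mult_right_mono norm_ge_zero order_trans)
    qed
  qed simp
  have "norm x \<le> (c + \<eta>) * norm x" for x :: 'w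
    using bound[of x 0] S(2) by simp
  then show ?thesis using that[OF S(1)] bound by blast
qed

text \<open>\<open>c + \<eta>\<close> bounds the norm of \<open>S 1 - S 0\<close>. Unlike the bound
  by 1 below, this also covers the zero space.\<close>

lemma UBAP_nonneg:
  assumes "UBAP TYPE('w::banach) c"
  shows "0 \<le> c"
proof (rule field_le_epsilon)
  fix \<eta> :: real assume "0 < \<eta>"
  then obtain S :: "nat \<Rightarrow> 'w \<Rightarrow>\<^sub>L 'w" where
    "\<forall>N\<ge>1. \<forall>\<theta> :: nat \<Rightarrow> real. (\<forall>i. \<theta> i \<in> {1, -1}) \<longrightarrow>
      norm (\<Sum>i=1..N. \<theta> i *\<^sub>R (S i - S (i - 1))) \<le> c + \<eta>"
    using assms unfolding UBAP_def by blast
  from this[THEN spec[of _ 1], THEN mp, THEN spec[of _ "\<lambda>_. 1"]]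
  have "norm (S 1 - S 0) \<le> c + \<eta>" by simp
  then show "0 \<le> c + \<eta>" by (rule order_trans[OF norm_ge_zero])
qed

lemma UBAP_ge_1:
  fixes x :: "'w::banach"
  assumes "UBAP TYPE('w) c" "x \<noteq> 0"
  shows "1 \<le> c"
proof (rule field_le_epsilon)
  fix \<eta> :: real assume \<eta>: "0 < \<eta>"
  obtain S :: "nat \<Rightarrow> 'w \<Rightarrow>\<^sub>L 'w" where "\<And>x::'w. norm x \<le> (c + \<eta>) * norm x"
    using UBAP_sequence[OF assms(1) \<eta>] by metis
  from this[of x] show "1 \<le> c + \<eta>" using assms(2) by simp
qed

text \<open>Lower semicontinuity of the operator norm under strong convergence: a uniform bound on
  the \<open>F n\<close> passes to the pointwise limit. The index is at least 1 because
  approximating sequences are constrained only from there on.\<close>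

lemma norm_strong_limit:
  fixes F :: "nat \<Rightarrow> 'a::real_normed_vector \<Rightarrow>\<^sub>L 'b::real_normed_vector" and T :: "'a \<Rightarrow>\<^sub>L 'b"
  assumes "\<And>x. (\<lambda>n. F n x) \<longlonglongrightarrow> T x" "0 < \<eta>"
  shows "\<exists>n\<ge>1. norm T - \<eta> \<le> norm (F n)"
proof (rule ccontr)
  assume "\<not> ?thesis"
  then have less: "norm (F n) < norm T - \<eta>" if "1 \<le> n" for n
    using that by (meson not_le)
  have "norm T \<le> norm T - \<eta>"
  proof (rule norm_blinfun_bound)
    show "0 \<le> norm T - \<eta>" using less[of 1] norm_ge_zero[of "F 1"] by linarith
    show "norm (T x) \<le> (norm T - \<eta>) * norm x" for x
    proof (rule tendsto_upperbound)
      show "(\<lambda>n. norm (F n x)) \<longlonglongrightarrow> norm (T x)" by (intro tendsto_intros assms)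
      show "\<forall>\<^sub>F n in sequentially. norm (F n x) \<le> (norm T - \<eta>) * norm x"
        using eventually_ge_at_top[of 1]
        by eventually_elim (meson less less_imp_le mult_right_mono norm_blinfun norm_ge_zero order_trans)
    qed simp
  qed
  then show False using assms(2) by simp
qed

text \<open>Take \<open>F = S n o\<^sub>L T\<close>. With \<open>S n\<close> written as a fixed sum
  of rank-one operators, \<open>T\<close> enters only through the functionals
  \<open>f b o\<^sub>L T\<close>, which lie in the separable dual of the domain.\<close>

lemma UBAP_codomain_approx:
  assumes sep: "separable_space (euclidean :: ('a::real_normed_vector \<Rightarrow>\<^sub>L real) topology)"
    and U: "UBAP TYPE('b::banach) c" and \<eta>: "0 < \<eta>"
  shows "\<exists>D :: ('a \<Rightarrow>\<^sub>L 'b) set. countable D \<and> (\<forall>T. \<exists>F \<in> closure D. compact_operator F \<and>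
    norm (T - 2 *\<^sub>R F) \<le> (c + \<eta>) * norm T \<and> norm T - \<eta> \<le> norm F)"
proof -
  have c: "0 \<le> c" using U by (rule UBAP_nonneg)
  obtain S :: "nat \<Rightarrow> 'b \<Rightarrow>\<^sub>L 'b" where S: "approximating_sequence S"
    "\<And>n x. 1 \<le> n \<Longrightarrow> norm (x - 2 *\<^sub>R S n x) \<le> (c + \<eta>) * norm x"
    using UBAP_sequence[OF U \<eta>] by metis
  have rank: "finite_rank (S n)" if "1 \<le> n" for n
    using S(1) that by (simp add: approximating_sequence_def)
  have "\<exists>D :: ('a \<Rightarrow>\<^sub>L 'b) set. countable D \<and> (\<forall>T. S n o\<^sub>L T \<in> closure D)" if n: "1 \<le> n" for n
  proof -
    obtain B and f :: "'b \<Rightarrow> 'b \<Rightarrow>\<^sub>L real" where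
      Bf: "finite B" "S n = (\<Sum>b\<in>B. blinfun_scaleR_left b o\<^sub>L f b)"
      using finite_rank_representation[OF rank[OF n]] .
    have cont: "continuous_on UNIV (\<lambda>h :: 'a \<Rightarrow>\<^sub>L real. blinfun_scaleR_left b o\<^sub>L h)" for b :: 'b
      by (intro continuous_intros)
    obtain D :: "('a \<Rightarrow>\<^sub>L 'b) set" where D: "countable D"
      "\<And>h. (\<Sum>b\<in>B. blinfun_scaleR_left b o\<^sub>L h b :: 'a \<Rightarrow>\<^sub>L 'b) \<in> closure D"
      using separable_finite_sums[where g = "\<lambda>b h. blinfun_scaleR_left b o\<^sub>L h", OF sep Bf(1) cont]
      by blast
    have "S n o\<^sub>L T = (\<Sum>b\<in>B. blinfun_scaleR_left b o\<^sub>L (f b o\<^sub>L T))" for T :: "'a \<Rightarrow>\<^sub>L 'b"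
      by (intro blinfun_eqI) (simp add: Bf(2) blinfun.sum_left)
    then show ?thesis using D by metis
  qed
  then obtain D :: "nat \<Rightarrow> ('a \<Rightarrow>\<^sub>L 'b) set" where
    D: "\<And>n. 1 \<le> n \<Longrightarrow> countable (D n)" "\<And>n T. 1 \<le> n \<Longrightarrow> S n o\<^sub>L T \<in> closure (D n)"
    by metis
  \<comment> \<open>The index \<open>n\<close> depends on \<open>T\<close>, hence the union of the
    countable sets over all \<open>n\<close>.\<close>
  have "\<exists>F \<in> closure (\<Union>n\<in>{1..}. D n). compact_operator F \<and>
    norm (T - 2 *\<^sub>R F) \<le> (c + \<eta>) * norm T \<and> norm T - \<eta> \<le> norm F" for T
  proof -
    have "(\<lambda>n. (S n o\<^sub>L T) x) \<longlonglongrightarrow> T x" for x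
      using S(1) by (simp add: approximating_sequence_def)
    from norm_strong_limit[OF this \<eta>] obtain n
      where n: "1 \<le> n" "norm T - \<eta> \<le> norm (S n o\<^sub>L T)" by blast
    have "norm ((T - 2 *\<^sub>R (S n o\<^sub>L T)) x) \<le> (c + \<eta>) * norm T * norm x" for x
    proof -
      have "norm ((T - 2 *\<^sub>R (S n o\<^sub>L T)) x) \<le> (c + \<eta>) * norm (T x)"
        using S(2)[OF n(1), of "T x"] by (simp add: blinfun.diff_left blinfun.scaleR_left)
      also have "\<dots> \<le> (c + \<eta>) * (norm T * norm x)"
        using c \<eta> by (intro mult_left_mono norm_blinfun) auto
      finally show ?thesis by (simp add: ac_simps)
    qed
    then have "norm (T - 2 *\<^sub>R (S n o\<^sub>L T)) \<le> (c + \<eta>) * norm T"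
      using c \<eta> by (intro norm_blinfun_bound) auto
    moreover have "compact_operator (S n o\<^sub>L T)"
      by (intro finite_rank_imp_compact finite_rank_compose_left rank n)
    moreover have "S n o\<^sub>L T \<in> closure (\<Union>n\<in>{1..}. D n)"
      using D(2)[OF n(1), of T] n(1) closure_mono[of "D n" "\<Union>n\<in>{1..}. D n"] by auto
    ultimately show ?thesis using n(2) by blast
  qed
  moreover have "countable (\<Union>n\<in>{1..}. D n)" using D(1) by auto
  ultimately show ?thesis by blast
qed

text \<open>Take \<open>F = T o\<^sub>L S n\<close>. Now the functionals \<open>f b\<close> are
  fixed and \<open>T\<close> enters only through the vectors \<open>T b\<close>, which lie in the
  separable codomain.\<close>

lemma UBAP_domain_approx:
  assumes sep: "separable_space (euclidean :: 'b::real_normed_vector topology)"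
    and U: "UBAP TYPE('a::banach) c" and \<eta>: "0 < \<eta>"
  shows "\<exists>D :: ('a \<Rightarrow>\<^sub>L 'b) set. countable D \<and> (\<forall>T. \<exists>F \<in> closure D. compact_operator F \<and>
    norm (T - 2 *\<^sub>R F) \<le> (c + \<eta>) * norm T \<and> norm T - \<eta> \<le> norm F)"
proof -
  have c: "0 \<le> c" using U by (rule UBAP_nonneg)
  obtain S :: "nat \<Rightarrow> 'a \<Rightarrow>\<^sub>L 'a" where S: "approximating_sequence S"
    "\<And>n x. 1 \<le> n \<Longrightarrow> norm (x - 2 *\<^sub>R S n x) \<le> (c + \<eta>) * norm x"
    using UBAP_sequence[OF U \<eta>] by metis
  have rank: "finite_rank (S n)" if "1 \<le> n" for n
    using S(1) that by (simp add: approximating_sequence_def)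
  have "\<exists>D :: ('a \<Rightarrow>\<^sub>L 'b) set. countable D \<and> (\<forall>T. T o\<^sub>L S n \<in> closure D)" if n: "1 \<le> n" for n
  proof -
    obtain B and f :: "'a \<Rightarrow> 'a \<Rightarrow>\<^sub>L real" where
      Bf: "finite B" "S n = (\<Sum>b\<in>B. blinfun_scaleR_left b o\<^sub>L f b)"
      using finite_rank_representation[OF rank[OF n]] .
    have cont: "continuous_on UNIV (\<lambda>y :: 'b. blinfun_scaleR_left y o\<^sub>L f b)" for b
      by (intro continuous_intros)
    obtain D :: "('a \<Rightarrow>\<^sub>L 'b) set" where D: "countable D"
      "\<And>h. (\<Sum>b\<in>B. blinfun_scaleR_left (h b) o\<^sub>L f b) \<in> closure D"
      using separable_finite_sums[where g = "\<lambda>b y. blinfun_scaleR_left y o\<^sub>L f b", OF sep Bf(1) cont]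
      by blast
    have "T o\<^sub>L S n = (\<Sum>b\<in>B. blinfun_scaleR_left (T b) o\<^sub>L f b)" for T :: "'a \<Rightarrow>\<^sub>L 'b"
      by (intro blinfun_eqI)
        (simp add: Bf(2) blinfun.sum_left blinfun.sum_right blinfun.scaleR_right)
    then show ?thesis using D by metis
  qed
  then obtain D :: "nat \<Rightarrow> ('a \<Rightarrow>\<^sub>L 'b) set" where
    D: "\<And>n. 1 \<le> n \<Longrightarrow> countable (D n)" "\<And>n T. 1 \<le> n \<Longrightarrow> T o\<^sub>L S n \<in> closure (D n)"
    by metis
  have "\<exists>F \<in> closure (\<Union>n\<in>{1..}. D n). compact_operator F \<and>
    norm (T - 2 *\<^sub>R F) \<le> (c + \<eta>) * norm T \<and> norm T - \<eta> \<le> norm F" for T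
  proof -
    have "(\<lambda>n. (T o\<^sub>L S n) x) \<longlonglongrightarrow> T x" for x
      using S(1) by (auto simp: approximating_sequence_def intro!: tendsto_intros)
    from norm_strong_limit[OF this \<eta>] obtain n
      where n: "1 \<le> n" "norm T - \<eta> \<le> norm (T o\<^sub>L S n)" by blast
    have "norm ((T - 2 *\<^sub>R (T o\<^sub>L S n)) x) \<le> (c + \<eta>) * norm T * norm x" for x
    proof -
      \<comment> \<open>\<open>T\<close> is factored out on the left, so the estimate for
        \<open>S n\<close> applies at \<open>x\<close> itself.\<close>
      have "norm ((T - 2 *\<^sub>R (T o\<^sub>L S n)) x) = norm (T (x - 2 *\<^sub>R S n x))"
        by (simp add: blinfun.bilinear_simps)
      also have "\<dots> \<le> norm T * norm (x - 2 *\<^sub>R S n x)" by (rule norm_blinfun)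
      also have "\<dots> \<le> norm T * ((c + \<eta>) * norm x)"
        using S(2)[OF n(1)] by (intro mult_left_mono) auto
      finally show ?thesis by (simp add: ac_simps)
    qed
    then have "norm (T - 2 *\<^sub>R (T o\<^sub>L S n)) \<le> (c + \<eta>) * norm T"
      using c \<eta> by (intro norm_blinfun_bound) auto
    moreover have "compact_operator (T o\<^sub>L S n)"
      by (intro finite_rank_imp_compact finite_rank_compose_right rank n)
    moreover have "T o\<^sub>L S n \<in> closure (\<Union>n\<in>{1..}. D n)"
      using D(2)[OF n(1), of T] n(1) closure_mono[of "D n" "\<Union>n\<in>{1..}. D n"] by auto
    ultimately show ?thesis using n(2) by blast
  qed
  moreover have "countable (\<Union>n\<in>{1..}. D n)" using D(1) by auto
  ultimately show ?thesis by blast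
qed

section \<open>The covering for approximation on either side\<close>

theorem theorem1p3:
  fixes \<epsilon> :: real
  assumes "separable_space (euclidean :: ('a::banach \<Rightarrow>\<^sub>L real) topology)"
    and "separable_space (euclidean :: 'b::banach topology)"
    and "0 < \<epsilon>"
    and "UBAP TYPE('a) (2 - \<epsilon>) \<or> UBAP TYPE('b) (2 - \<epsilon>)"
  shows "\<forall>\<alpha>. 1 - \<epsilon> / 2 < \<alpha> \<and> \<alpha> \<le> 1 \<longrightarrow>
    (\<forall>\<sigma>. 0 < \<sigma> \<and> \<sigma> < 2 * \<alpha> + \<epsilon> - 2 \<longrightarrow>
      UBCP (alpha_norm \<alpha> :: ('a \<Rightarrow>\<^sub>L 'b) \<Rightarrow> real) (2 * \<alpha>) (2 * \<alpha> + \<epsilon> - 2 - \<sigma>))"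
proof (intro allI impI; elim conjE)
  fix \<alpha> \<sigma> :: real
  assume \<alpha>: "1 - \<epsilon> / 2 < \<alpha>" "\<alpha> \<le> 1" and \<sigma>: "0 < \<sigma>" "\<sigma> < 2 * \<alpha> + \<epsilon> - 2"
  show "UBCP (alpha_norm \<alpha> :: ('a \<Rightarrow>\<^sub>L 'b) \<Rightarrow> real) (2 * \<alpha>) (2 * \<alpha> + \<epsilon> - 2 - \<sigma>)"
  \<comment> \<open>A nonzero operator makes both spaces nonzero, so
    \<open>\<epsilon> \<le> 1\<close> follows whichever of them has the approximation
    property.\<close>
  proof (cases "\<exists>T :: 'a \<Rightarrow>\<^sub>L 'b. T \<noteq> 0")
    case True
    then obtain T :: "'a \<Rightarrow>\<^sub>L 'b" and x where "T x \<noteq> 0" by (metis blinfun_eqI blinfun.zero_left)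
    then have "T x \<noteq> 0" "x \<noteq> 0" by (auto simp: blinfun.zero_right)
    then have "1 \<le> 2 - \<epsilon>" using assms(4) UBAP_ge_1[of _ "T x"] UBAP_ge_1[of _ x] by blast
    then have \<epsilon>: "\<epsilon> \<le> 1" by simp
    show ?thesis
      using UBAP_domain_approx[OF assms(2)] UBAP_codomain_approx[OF assms(1)] assms(4)
      by (intro UBCP_alpha_norm[OF assms(3) \<epsilon> \<alpha> \<sigma>]) blast
  next
    case False
    then have "T = 0" for T :: "'a \<Rightarrow>\<^sub>L 'b" by blast
    moreover have "alpha_norm \<alpha> (0 :: 'a \<Rightarrow>\<^sub>L 'b) = 0"
      by (simp add: alpha_norm_def compact_operator_zero)
    ultimately have "alpha_norm \<alpha> T = 0" for T :: "'a \<Rightarrow>\<^sub>L 'b" by metis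
    \<comment> \<open>Here the unit sphere is empty and no balls are needed;
      \<open>\<epsilon> \<le> 2\<close> gives \<open>0 < \<alpha>\<close>, so the radius bound
      \<open>2 * \<alpha>\<close> is positive.\<close>
    moreover have "0 \<le> 2 - \<epsilon>" using assms(4) by (elim disjE) (erule UBAP_nonneg)+
    ultimately show ?thesis
      unfolding UBCP_def using \<alpha> \<sigma> by (intro conjI exI[of _ "{}"]) auto
  qed
qed

end
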